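(* Let $\mathsf{M}$ be a matroid on $[n]$ and let $f=\{f_\sigma:\sigma\in S_n\}\in\mathrm{PLaur}(\Sigma_n)$. For any $\mu\in S_{n-1}$, $$\sum_{\sigma\in S_n(\mu)}f_\sigma\,Q(C_\sigma)\prod_{i\in[n]\setminus B_{\mathsf{M}}(\sigma)}(1-x_i)=f_\mu\,Q(C_\mu)\prod_{i\in[n-1]\setminus B_{\mathsf{M}\setminus\{n\}}(\mu)}(1-x_i),$$ where: (1) the Laurent polynomials $f_\mu\in\mathbb{Z}[x_1^{\pm1},\dots,x_n^{\pm1}]$ ($\mu\in S_{n-1}$) are given by $$f_\mu=\begin{cases} h_\mu & \text{if } n\text{ is a coloop of }\mathsf{M}, \\ (1-x_n)h_\mu & \text{if } n\text{ is a loop of }\mathsf{M}, \\ h_\mu-x_n\Big(\sum_{j=1}^{k}x_{\mu(k)}g_{\mu,j}+\sum_{j=k+1}^{n-1}x_{\mu(j)}g_{\mu,j}\Big) & \text{otherwise},\end{cases}$$ where in the third case $k=k_{\mathsf{M}}(\mu)$; (2) the collection $\{f_\mu:\mu\in S_{n-1}\}$ is an element of $\mathrm{PLaur}(\Sigma_{n-1})\otimes_{\mathbb{Z}}\mathbb{Z}[x_n^{\pm1}]$.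
   Context: $[n]=\{1,\dots,n\}$; $S_n$ is the set of permutations of $[n]$; $\tau_i$ is the adjacent transposition swapping $i$ and $i+1$. Empty products equal $1$ (when $n=1$, $S_0$ consists of the empty permutation). $\mathrm{PLaur}(\Sigma_n)$ is the ring of collections $f=\{f_\sigma:\sigma\in S_n\}$, $f_\sigma\in\mathbb{Z}[x_1^{\pm1},\dots,x_n^{\pm1}]$, such that for all $\sigma\in S_n$, $i\in[n-1]$, $f_\sigma-f_{\sigma\circ\tau_i}$ is divisible by $x_{\sigma(i)}-x_{\sigma(i+1)}$ in $\mathbb{Z}[x_1^{\pm1},\dots,x_n^{\pm1}]$. A collection $\{f_\mu:\mu\in S_{n-1}\}$ with $f_\mu\in\mathbb{Z}[x_1^{\pm1},\dots,x_n^{\pm1}]$ is viewed as an element of $\mathrm{PLaur}(\Sigma_{n-1})\otimes_{\mathbb{Z}}\mathbb{Z}[x_n^{\pm1}]$ when $f_\mu-f_{\mu\circ\tau_i}$ is divisible by $x_{\mu(i)}-x_{\mu(i+1)}$ in $\mathbb{Z}[x_1^{\pm1},\dots,x_n^{\pm1}]$ for all $\mu\in S_{n-1}$, $i\in[n-2]$ (equivalently, for each $m$ the coefficients of $x_n^m$ form an element of $\mathrm{PLaur}(\Sigma_{n-1})$). For $\sigma\in S_m$, $Q(C_\sigma)=1/\prod_{i=1}^{m-1}\left(1-\frac{x_{\sigma(i+1)}}{x_{\sigma(i)}}\right)$. For a matroid $\mathsf{N}$ on $[m]$ and $\sigma\in S_m$, the greedy basis is $B_{\mathsf{N}}(\sigma)=\{\sigma(i):\mathrm{rk}_{\mathsf{N}}\{\sigma(1),\dots,\sigma(i)\}>\mathrm{rk}_{\mathsf{N}}\{\sigma(1),\dots,\sigma(i-1)\}\}$.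 $\mathsf{M}\setminus\{n\}$ is the deletion, i.e. the restriction of $\mathsf{M}$ to $[n-1]$. A loop is an element in no basis; a coloop is an element in every basis. For $\mu\in S_{n-1}$ and $i\in[n]$, $\mu_i\in S_n$ is the permutation obtained from $\mu$ (in one-line notation) by inserting $n$ in position $i$, so $\mu_i(i)=n$; $S_n(\mu)=\{\mu_1,\dots,\mu_n\}$. For $f\in\mathrm{PLaur}(\Sigma_n)$ and $j=1,\dots,n-1$, define the Laurent polynomials $$g_{\mu,j}=\frac{f_{\mu_j}-f_{\mu_{j+1}}}{x_n-x_{\mu(j)}},\qquad h_\mu=x_ng_{\mu,1}+\dots+x_ng_{\mu,n-1}+f_{\mu_n}.$$ If $n$ is neither a loop nor a coloop of $\mathsf{M}$, define $$k_{\mathsf{M}}(\mu)=\max\{i\in[n-1]:\mathrm{rk}_{\mathsf{M}}\{\mu(1),\dots,\mu(i-1)\}<\mathrm{rk}_{\mathsf{M}}\{\mu(1),\dots,\mu(i-1),n\}\}.$$ Note that $f_\sigma$ with $\sigma\in S_n$ denotes the given collection, whereas $f_\mu$ with $\mu\in S_{n-1}$ denotes the new Laurent polynomials defined in (1). *)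

theory Defs
  imports
    "HOL-Library.Poly_Mapping"
    "HOL-Computational_Algebra.Fraction_Field"
    "HOL-Combinatorics.Permutations"
begin

(* Laurent polynomials: the group ring over int of finitely supported integer exponent
   vectors. The type has the countably many variables x_0, x_1, ...; the subring in
   x_1, ..., x_n is Laurent n. *)

type_synonym laurent = "(nat \<Rightarrow>\<^sub>0 int) \<Rightarrow>\<^sub>0 int"

definition lvar :: "nat \<Rightarrow> laurent" where
  "lvar i = Poly_Mapping.single (Poly_Mapping.single i 1) 1"

definition Laurent :: "nat \<Rightarrow> laurent set" where
  "Laurent n = {p. \<forall>e\<in>Poly_Mapping.keys p. Poly_Mapping.keys e \<subseteq> {1..n}}"

definition Laurent_dvd :: "nat \<Rightarrow> laurent \<Rightarrow> laurent \<Rightarrow> bool" where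
  "Laurent_dvd n b a \<longleftrightarrow> (\<exists>q\<in>Laurent n. a = b * q)"

(* Exact division a / b inside Laurent n; the quotient is unique for b \<noteq> 0 because the
   ring is an integral domain, and the value is unspecified if b does not divide a. *)
definition Laurent_quot :: "nat \<Rightarrow> laurent \<Rightarrow> laurent \<Rightarrow> laurent" where
  "Laurent_quot n a b = (THE q. q \<in> Laurent n \<and> a = b * q)"

definition laurent_fract :: "laurent \<Rightarrow> laurent fract" where
  "laurent_fract p = Fraction_Field.Fract p 1"


(* Families indexed by S_m, given by functions whose values off S_m are irrelevant.
   Permutations of {1, ..., m} are functions on nat fixing everything else. *)
definition piecewise_Laurent :: "nat \<Rightarrow> nat \<Rightarrow> ((nat \<Rightarrow> nat) \<Rightarrow> laurent) set" where
  "piecewise_Laurent m n = {f. \<forall>\<sigma>. \<sigma> permutes {1..m} \<longrightarrow>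
     f \<sigma> \<in> Laurent n \<and>
     (\<forall>i\<in>{1..<m}. Laurent_dvd n (lvar (\<sigma> i) - lvar (\<sigma> (i + 1)))
                                (f \<sigma> - f (\<sigma> \<circ> transpose i (i + 1))))}"

definition PLaur :: "nat \<Rightarrow> ((nat \<Rightarrow> nat) \<Rightarrow> laurent) set" where
  "PLaur n = piecewise_Laurent n n"

(* PLaur(\<Sigma>_{n-1}) \<otimes> Z[x_n, 1/x_n], as families of Laurent polynomials in x_1, ..., x_n *)
definition PLaur_tensor :: "nat \<Rightarrow> ((nat \<Rightarrow> nat) \<Rightarrow> laurent) set" where
  "PLaur_tensor n = piecewise_Laurent (n - 1) n"


(* Q(C_\<sigma>) for \<sigma> in S_m *)
definition Q_cone :: "nat \<Rightarrow> (nat \<Rightarrow> nat) \<Rightarrow> laurent fract" where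
  "Q_cone m \<sigma> = 1 / (\<Prod>i\<in>{1..<m}. 1 - laurent_fract (lvar (\<sigma> (i + 1))) / laurent_fract (lvar (\<sigma> i)))"


(* A matroid on E is given by its set I of independent sets. *)
definition matroid_on :: "'a set \<Rightarrow> 'a set set \<Rightarrow> bool" where
  "matroid_on E I \<longleftrightarrow> finite E \<and> I \<subseteq> Pow E \<and> {} \<in> I \<and>
     (\<forall>A B. B \<in> I \<and> A \<subseteq> B \<longrightarrow> A \<in> I) \<and>
     (\<forall>A\<in>I. \<forall>B\<in>I. card A < card B \<longrightarrow> (\<exists>x\<in>B - A. insert x A \<in> I))"

definition bases :: "'a set set \<Rightarrow> 'a set set" where
  "bases I = {B \<in> I. \<forall>A\<in>I. B \<subseteq> A \<longrightarrow> A = B}"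

definition rk :: "'a set set \<Rightarrow> 'a set \<Rightarrow> nat" where
  "rk I A = Max (card ` {J \<in> I. J \<subseteq> A})"

definition deletion :: "'a set set \<Rightarrow> 'a set \<Rightarrow> 'a set set" where
  "deletion I D = {J \<in> I. J \<inter> D = {}}"

definition is_loop :: "'a set set \<Rightarrow> 'a \<Rightarrow> bool" where
  "is_loop I e \<longleftrightarrow> (\<forall>B\<in>bases I. e \<notin> B)"

definition is_coloop :: "'a set set \<Rightarrow> 'a \<Rightarrow> bool" where
  "is_coloop I e \<longleftrightarrow> (\<forall>B\<in>bases I. e \<in> B)"

definition greedy_basis :: "nat set set \<Rightarrow> nat \<Rightarrow> (nat \<Rightarrow> nat) \<Rightarrow> nat set" where
  "greedy_basis I m \<sigma> = {\<sigma> i |i. i \<in> {1..m} \<and> rk I (\<sigma> ` {1..i}) > rk I (\<sigma> ` {1..<i})}"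


(* \<mu>_i, for \<mu> in S_{n-1} and i in {1, ..., n} *)
definition ins :: "nat \<Rightarrow> (nat \<Rightarrow> nat) \<Rightarrow> nat \<Rightarrow> (nat \<Rightarrow> nat)" where
  "ins n \<mu> i = (\<lambda>p. if p = i then n else if i < p \<and> p \<le> n then \<mu> (p - 1) else \<mu> p)"

definition insertions :: "nat \<Rightarrow> (nat \<Rightarrow> nat) \<Rightarrow> (nat \<Rightarrow> nat) set" where
  "insertions n \<mu> = ins n \<mu> ` {1..n}"

definition g_poly ::
  "nat \<Rightarrow> ((nat \<Rightarrow> nat) \<Rightarrow> laurent) \<Rightarrow> (nat \<Rightarrow> nat) \<Rightarrow> nat \<Rightarrow> laurent" where
  "g_poly n f \<mu> j =
     Laurent_quot n (f (ins n \<mu> j) - f (ins n \<mu> (j + 1))) (lvar n - lvar (\<mu> j))"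

definition h_poly ::
  "nat \<Rightarrow> ((nat \<Rightarrow> nat) \<Rightarrow> laurent) \<Rightarrow> (nat \<Rightarrow> nat) \<Rightarrow> laurent" where
  "h_poly n f \<mu> = (\<Sum>j\<in>{1..<n}. lvar n * g_poly n f \<mu> j) + f (ins n \<mu> n)"

definition k_index :: "nat set set \<Rightarrow> nat \<Rightarrow> (nat \<Rightarrow> nat) \<Rightarrow> nat" where
  "k_index I n \<mu> =
     Max {i \<in> {1..<n}. rk I (\<mu> ` {1..<i}) < rk I (insert n (\<mu> ` {1..<i}))}"

(* the family f_\<mu>, \<mu> in S_{n-1}, obtained from f_\<sigma>, \<sigma> in S_n *)
definition push_family ::
  "nat set set \<Rightarrow> nat \<Rightarrow> ((nat \<Rightarrow> nat) \<Rightarrow> laurent) \<Rightarrow> (nat \<Rightarrow> nat) \<Rightarrow> laurent" where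
  "push_family I n f \<mu> =
     (if is_coloop I n then h_poly n f \<mu>
      else if is_loop I n then (1 - lvar n) * h_poly n f \<mu>
      else let k = k_index I n \<mu> in
        h_poly n f \<mu> - lvar n * ((\<Sum>j\<in>{1..k}. lvar (\<mu> k) * g_poly n f \<mu> j)
                              + (\<Sum>j\<in>{k+1..<n}. lvar (\<mu> j) * g_poly n f \<mu> j)))"

end

theory Submission
  imports Defs
begin

text \<open>
  Write \<open>y\<^sub>j\<close> for the variable indexed by \<open>\<mu>(j)\<close> and \<open>x\<close> for \<open>x\<^sub>n\<close>, and put
  \<open>A\<^sub>0 = 0\<close>, \<open>A\<^sub>j = x / (x - y\<^sub>j)\<close> for \<open>0 < j < n\<close>, and \<open>A\<^sub>n = 1\<close>. By partial fractions the ratio of the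
  cone functions of \<open>\<mu>\<^sub>i\<close> and \<open>\<mu>\<close> is \<open>A\<^sub>i - A\<^sub>i\<^sub>-\<^sub>1\<close>, so the sum over the insertions telescopes by
  summation by parts, the differences of consecutive \<open>f\<close> being \<open>(x - y\<^sub>j) g\<^sub>j\<close>. The set of \<open>i\<close> for
  which \<open>n\<close> raises the rank of the first \<open>i - 1\<close> elements is an initial segment. If \<open>n\<close> is neither
  a loop nor a coloop, this is \<open>i \<le> k\<close> with \<open>0 < k < n\<close>; for such
  \<open>i\<close> the element \<open>n\<close> replaces \<open>\<mu>(k)\<close> in the greedy basis, otherwise \<open>n\<close> is not in the greedy basis.

  For membership in the tensor product, the family is written as \<open>f\<close> at the last insertion plus the
  sum of \<open>x (1 - w\<^sub>j) g\<^sub>j\<close> with \<open>w\<^sub>j\<close> the variable \<open>y\<close> at \<open>max j k\<close>. Divisibility by a difference of two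
  variables means vanishing under the substitution identifying them, and that substitution preserves
  each weight and makes the two weights at the transposed positions equal.
\<close>

subsection \<open>Laurent polynomials\<close>

lemma Laurent_0 [simp]: "0 \<in> Laurent n"
  by (simp add: Laurent_def)

lemma Laurent_single:
  assumes "Poly_Mapping.keys e \<subseteq> {1..n}"
  shows "Poly_Mapping.single e c \<in> Laurent n"
  using assms by (auto simp: Laurent_def)

lemma Laurent_1 [simp]: "1 \<in> Laurent n"
  unfolding single_one[symmetric] by (rule Laurent_single) simp

lemma Laurent_lvar: "i \<in> {1..n} \<Longrightarrow> lvar i \<in> Laurent n"
  unfolding lvar_def by (rule Laurent_single) simp

lemma Laurent_add: "p \<in> Laurent n \<Longrightarrow> q \<in> Laurent n \<Longrightarrow> p + q \<in> Laurent n"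
  using keys_add[of p q] by (fastforce simp: Laurent_def)

lemma Laurent_uminus: "p \<in> Laurent n \<Longrightarrow> - p \<in> Laurent n"
  by (simp add: Laurent_def)

lemma Laurent_diff: "p \<in> Laurent n \<Longrightarrow> q \<in> Laurent n \<Longrightarrow> p - q \<in> Laurent n"
  using Laurent_add[of p n "- q"] Laurent_uminus[of q n] by simp

lemma Laurent_mult:
  assumes "p \<in> Laurent n" "q \<in> Laurent n"
  shows "p * q \<in> Laurent n"
  unfolding Laurent_def
proof safe
  fix e i assume "e \<in> Poly_Mapping.keys (p * q)" "i \<in> Poly_Mapping.keys e"
  then obtain a b where "a \<in> Poly_Mapping.keys p" "b \<in> Poly_Mapping.keys q" "e = a + b"
    using keys_mult[of p q] by auto
  with \<open>i \<in> Poly_Mapping.keys e\<close> show "i \<in> {1..n}"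
    using keys_add[of a b] assms unfolding Laurent_def by blast
qed

lemma Laurent_sum: "(\<And>i. i \<in> A \<Longrightarrow> p i \<in> Laurent n) \<Longrightarrow> (\<Sum>i\<in>A. p i) \<in> Laurent n"
  by (induction A rule: infinite_finite_induct) (auto intro: Laurent_add)

lemmas Laurent_intros = Laurent_lvar Laurent_add Laurent_diff Laurent_mult Laurent_sum

lemma lvar_eq_iff [simp]: "lvar i = lvar j \<longleftrightarrow> i = j"
  unfolding lvar_def frag_of_eq ..

lemma lvar_nonzero [simp]: "lvar i \<noteq> 0"
  by (simp add: lvar_def)

section \<open>Identification of two variables\<close>

definition subst_exp :: "nat \<Rightarrow> nat \<Rightarrow> (nat \<Rightarrow>\<^sub>0 int) \<Rightarrow> (nat \<Rightarrow>\<^sub>0 int)" where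
  "subst_exp a b = frag_extend (\<lambda>i. frag_of (if i = b then a else i))"

text \<open>Exponent vectors form the free abelian group on the variables, and Laurent polynomials
  the free abelian group on exponent vectors. Extending additively at both levels puts variable
  \<open>a\<close> in place of variable \<open>b\<close>, negative exponents included.\<close>

definition subst_var :: "nat \<Rightarrow> nat \<Rightarrow> laurent \<Rightarrow> laurent" where
  "subst_var a b = frag_extend (\<lambda>e. frag_of (subst_exp a b e))"

lemma subst_var_0 [simp]: "subst_var a b 0 = 0"
  by (simp add: subst_var_def)

lemma subst_var_1 [simp]: "subst_var a b 1 = 1"
  unfolding subst_var_def single_one[symmetric] frag_extend_of
  by (simp add: subst_exp_def)

lemma subst_var_lvar [simp]: "subst_var a b (lvar i) = lvar (if i = b then a else i)"
  by (simp add: subst_var_def lvar_def subst_exp_def)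

lemma subst_var_add: "subst_var a b (p + q) = subst_var a b p + subst_var a b q"
  by (simp add: subst_var_def frag_extend_add)

lemma subst_var_diff: "subst_var a b (p - q) = subst_var a b p - subst_var a b q"
  by (simp add: subst_var_def frag_extend_diff)

lemma subst_var_sum: "subst_var a b (\<Sum>i\<in>A. p i) = (\<Sum>i\<in>A. subst_var a b (p i))"
  by (induction A rule: infinite_finite_induct) (auto simp: subst_var_add)

lemma frag_of_mult: "frag_of e * frag_of e' = frag_of (e + e' :: 'a :: comm_monoid_add)"
  by (simp add: mult_single)

text \<open>Both sides are additive in \<open>p\<close> and in \<open>q\<close>, so a double
  induction reduces the claim to monomials, where it is additivity of
  \<open>subst_exp\<close>.\<close>

lemma subst_var_mult: "subst_var a b (p * q) = subst_var a b p * subst_var a b q"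
proof (induction p rule: frag_induction[OF subset_UNIV])
  case (2 e)
  show ?case
  proof (induction q rule: frag_induction[OF subset_UNIV])
    case (2 e')
    show ?case
      by (simp add: frag_of_mult subst_var_def subst_exp_def frag_extend_add)
  qed (simp_all add: subst_var_diff right_diff_distrib)
qed (simp_all add: subst_var_diff left_diff_distrib)

lemmas subst_var_hom = subst_var_add subst_var_diff subst_var_mult subst_var_sum

lemma keys_subst_exp:
  assumes "a \<in> {1..n}" "Poly_Mapping.keys e \<subseteq> {1..n}"
  shows "Poly_Mapping.keys (subst_exp a b e) \<subseteq> {1..n}"
  unfolding subst_exp_def using assms by (intro order_trans[OF keys_frag_extend]) auto

section \<open>Divisibility by a difference of two variables\<close>

lemma Laurent_dvd_diff: "Laurent_dvd n d p \<Longrightarrow> Laurent_dvd n d q \<Longrightarrow> Laurent_dvd n d (p - q)"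
  unfolding Laurent_dvd_def by (metis Laurent_diff right_diff_distrib)

lemma Laurent_dvd_mult: "Laurent_dvd n d p \<Longrightarrow> q \<in> Laurent n \<Longrightarrow> Laurent_dvd n d (q * p)"
  unfolding Laurent_dvd_def by (metis Laurent_mult mult.left_commute)

lemma Laurent_dvd_0 [simp]: "Laurent_dvd n d 0"
  unfolding Laurent_dvd_def by (rule bexI[of _ 0]) auto

lemma Laurent_dvd_diff_subst_exp:
  assumes "a \<in> {1..n}" "b \<in> {1..n}" "Poly_Mapping.keys e \<subseteq> {1..n}"
  shows "Laurent_dvd n (lvar a - lvar b) (frag_of e - frag_of (subst_exp a b e))"
proof -
  let ?s = "subst_exp a b" and ?d = "lvar a - lvar b"
  \<comment> \<open>The support condition is part of the induction statement because the difference
    case needs it for both exponent vectors.\<close>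
  have "Poly_Mapping.keys e \<subseteq> {1..n} \<and> Laurent_dvd n ?d (frag_of e - frag_of (?s e))"
    using assms(3)
  proof (induction e rule: frag_induction)
    case zero
    then show ?case by (simp add: subst_exp_def)
  next
    case (one i)
    have "Laurent_dvd n ?d (lvar b - lvar a)"
      unfolding Laurent_dvd_def by (rule bexI[of _ "- 1"]) (auto intro: Laurent_uminus)
    with one show ?case by (auto simp: subst_exp_def lvar_def)
  next
    case (diff e e')
    have keys: "Poly_Mapping.keys (?s e) \<subseteq> {1..n}" "Poly_Mapping.keys (?s e') \<subseteq> {1..n}"
      using diff assms(1) keys_subst_exp by auto
    then have keys': "Poly_Mapping.keys (?s e - e' - ?s e') \<subseteq> {1..n}"
      using diff keys_diff[of "?s e - e'" "?s e'"] keys_diff[of "?s e" "e'"] by blast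
    \<comment> \<open>The difference passes through the intermediate monomial with exponent
      \<open>?s e - e'\<close>, so that each part contains one of the differences from the induction
      hypothesis.\<close>
    have "frag_of (e - e') - frag_of (?s (e - e')) =
        frag_of (- e') * (frag_of e - frag_of (?s e))
        - frag_of (?s e - e' - ?s e') * (frag_of e' - frag_of (?s e'))"
      by (simp add: right_diff_distrib frag_of_mult subst_exp_def frag_extend_diff algebra_simps)
    also have "Laurent_dvd n ?d \<dots>"
      using diff keys' by (auto intro!: Laurent_dvd_diff[OF Laurent_dvd_mult Laurent_dvd_mult] Laurent_single)
    finally show ?case using diff keys_diff[of e e'] by auto
  qed
  then show ?thesis by blast
qed

lemma Laurent_dvd_diff_subst_var:
  assumes "a \<in> {1..n}" "b \<in> {1..n}" "p \<in> Laurent n"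
  shows "Laurent_dvd n (lvar a - lvar b) (p - subst_var a b p)"
proof -
  have "Poly_Mapping.keys p \<subseteq> {e. Poly_Mapping.keys e \<subseteq> {1..n}}"
    using assms(3) by (auto simp: Laurent_def)
  then show ?thesis
  proof (induction p rule: frag_induction)
    case (one e)
    then show ?case
      using Laurent_dvd_diff_subst_exp[OF assms(1,2)] by (simp add: subst_var_def)
  next
    case (diff p q)
    have "p - q - subst_var a b (p - q) = (p - subst_var a b p) - (q - subst_var a b q)"
      by (simp add: subst_var_diff)
    with diff Laurent_dvd_diff show ?case by metis
  qed simp
qed

text \<open>Factor theorem: \<open>p\<close> is congruent to its substitution modulo the difference
  of the variables, and the substitution kills that difference.\<close>

lemma Laurent_dvd_lvar_diff_iff:
  assumes "a \<in> {1..n}" "b \<in> {1..n}" "p \<in> Laurent n"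
  shows "Laurent_dvd n (lvar a - lvar b) p \<longleftrightarrow> subst_var a b p = 0"
proof
  assume "Laurent_dvd n (lvar a - lvar b) p"
  then show "subst_var a b p = 0"
    by (auto simp: Laurent_dvd_def subst_var_mult subst_var_diff)
next
  assume "subst_var a b p = 0"
  then show "Laurent_dvd n (lvar a - lvar b) p"
    using Laurent_dvd_diff_subst_var[OF assms] by simp
qed

section \<open>Exact division\<close>

lemma Laurent_quot:
  assumes "Laurent_dvd n b a" "b \<noteq> 0"
  shows "Laurent_quot n a b \<in> Laurent n" "a = b * Laurent_quot n a b"
proof -
  have "\<exists>!q. q \<in> Laurent n \<and> a = b * q"
    using assms unfolding Laurent_dvd_def by (metis mult_cancel_left)
  from theI'[OF this] show "Laurent_quot n a b \<in> Laurent n" "a = b * Laurent_quot n a b"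
    by (simp_all add: Laurent_quot_def)
qed

subsection \<open>Fractions\<close>

lemma laurent_fract_0 [simp]: "laurent_fract 0 = 0"
  by (simp add: laurent_fract_def fract_collapse)

lemma laurent_fract_1 [simp]: "laurent_fract 1 = 1"
  by (simp add: laurent_fract_def fract_collapse)

lemma laurent_fract_add [simp]: "laurent_fract (p + q) = laurent_fract p + laurent_fract q"
  by (simp add: laurent_fract_def)

lemma laurent_fract_diff [simp]: "laurent_fract (p - q) = laurent_fract p - laurent_fract q"
  by (simp add: laurent_fract_def)

lemma laurent_fract_mult [simp]: "laurent_fract (p * q) = laurent_fract p * laurent_fract q"
  by (simp add: laurent_fract_def)

lemma laurent_fract_sum: "laurent_fract (\<Sum>i\<in>A. p i) = (\<Sum>i\<in>A. laurent_fract (p i))"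
  by (induction A rule: infinite_finite_induct) auto

lemma laurent_fract_eq_iff [simp]: "laurent_fract p = laurent_fract q \<longleftrightarrow> p = q"
  by (simp add: laurent_fract_def eq_fract)

lemma laurent_fract_eq_0_iff [simp]: "laurent_fract p = 0 \<longleftrightarrow> p = 0"
  using laurent_fract_eq_iff[of p 0] by (simp del: laurent_fract_eq_iff)

subsection \<open>Matroid rank\<close>

context
  fixes E :: "'a set" and I :: "'a set set"
  assumes matroid: "matroid_on E I"
begin

lemma finite_indep: "finite I"
  using matroid finite_subset[of I "Pow E"] by (auto simp: matroid_on_def)

lemma indep_finite: "J \<in> I \<Longrightarrow> finite J"
  using matroid finite_subset[of J E] by (auto simp: matroid_on_def)

lemma indep_subset: "J \<in> I \<Longrightarrow> K \<subseteq> J \<Longrightarrow> K \<in> I"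
  using matroid unfolding matroid_on_def by blast

lemma indep_augment: "J \<in> I \<Longrightarrow> K \<in> I \<Longrightarrow> card J < card K \<Longrightarrow> \<exists>x\<in>K - J. insert x J \<in> I"
  using matroid by (auto simp: matroid_on_def)

lemma empty_indep: "{} \<in> I"
  using matroid by (auto simp: matroid_on_def)

lemma card_le_rk: "J \<in> I \<Longrightarrow> J \<subseteq> A \<Longrightarrow> card J \<le> rk I A"
  unfolding rk_def using finite_indep by (intro Max_ge) auto

lemma rk_witness: "\<exists>J\<in>I. J \<subseteq> A \<and> card J = rk I A"
proof -
  have "rk I A \<in> card ` {J \<in> I. J \<subseteq> A}"
    unfolding rk_def using finite_indep empty_indep by (intro Max_in) auto
  then show ?thesis by auto
qed

lemma rk_mono: "A \<subseteq> B \<Longrightarrow> rk I A \<le> rk I B"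
  using rk_witness[of A] card_le_rk[of _ B] by force

text \<open>A largest independent set between \<open>J\<close> and \<open>A\<close> attains the rank
  of \<open>A\<close>; otherwise a rank witness for \<open>A\<close> would augment it further inside
  \<open>A\<close>.\<close>

lemma indep_extend:
  assumes "J \<in> I" "J \<subseteq> A"
  shows "\<exists>K\<in>I. J \<subseteq> K \<and> K \<subseteq> A \<and> card K = rk I A"
proof -
  let ?S = "{K \<in> I. J \<subseteq> K \<and> K \<subseteq> A}"
  have "finite ?S" "?S \<noteq> {}" using assms finite_indep by auto
  then have "Max (card ` ?S) \<in> card ` ?S" by (intro Max_in) auto
  then obtain K where K: "Max (card ` ?S) = card K" "K \<in> ?S" by (rule imageE)
  then have K_max: "card K' \<le> card K" if "K' \<in> ?S" for K'
    using that \<open>finite ?S\<close> unfolding K(1)[symmetric] by (intro Max_ge) auto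
  obtain W where W: "W \<in> I" "W \<subseteq> A" "card W = rk I A" using rk_witness by blast
  have "\<not> card K < card W"
  proof
    assume "card K < card W"
    then obtain x where x: "x \<in> W - K" "insert x K \<in> I" using indep_augment K(2) W by blast
    with K W have "insert x K \<in> ?S" by auto
    from K_max[OF this] x K(2) indep_finite[of K] show False by simp
  qed
  moreover have "card K \<le> rk I A" using K card_le_rk by auto
  ultimately show ?thesis using K W by auto
qed

section \<open>Bases of a matroid\<close>

lemma indep_in_basis:
  assumes "J \<in> I"
  shows "\<exists>B\<in>bases I. J \<subseteq> B"
proof -
  have "J \<subseteq> E" using assms matroid by (auto simp: matroid_on_def)
  then obtain K where K: "K \<in> I" "J \<subseteq> K" "card K = rk I E" using indep_extend assms by blast
  have "A = K" if "A \<in> I" "K \<subseteq> A" for A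
  proof -
    have "A \<subseteq> E" using that matroid by (auto simp: matroid_on_def)
    then have "card A \<le> card K" using that K card_le_rk by simp
    with that show ?thesis using indep_finite card_seteq by metis
  qed
  with K show ?thesis by (auto simp: bases_def)
qed

lemma card_basis:
  assumes "B \<in> bases I"
  shows "card B = rk I E"
proof -
  have "B \<in> I" "B \<subseteq> E" using assms matroid by (auto simp: matroid_on_def bases_def)
  then obtain K where "K \<in> I" "B \<subseteq> K" "card K = rk I E" using indep_extend by blast
  with assms show ?thesis by (auto simp: bases_def)
qed

section \<open>Change of rank when one element is added\<close>

lemma rk_insert_le: "rk I (insert e A) \<le> Suc (rk I A)"
proof -
  obtain J where J: "J \<in> I" "J \<subseteq> insert e A" "card J = rk I (insert e A)" using rk_witness by blast
  have "card (J - {e}) \<le> rk I A"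
    using J indep_subset[of J "J - {e}"] by (intro card_le_rk) auto
  moreover have "card J \<le> Suc (card (J - {e}))"
    by (simp add: card_Diff_singleton_if) arith
  ultimately show ?thesis using J by simp
qed

text \<open>Diminishing returns: rank witnesses for \<open>A\<close>, \<open>B\<close> and
  \<open>insert e B\<close> can be chosen as a chain. The largest must contain \<open>e\<close>,
  hence adding \<open>e\<close> to the smallest keeps it independent.\<close>

lemma rk_insert_less_antimono:
  assumes "A \<subseteq> B" "rk I B < rk I (insert e B)"
  shows "rk I A < rk I (insert e A)"
proof -
  have "e \<notin> B" using assms(2) by (auto simp: insert_absorb)
  obtain J where J: "J \<in> I" "J \<subseteq> A" "card J = rk I A" using rk_witness by blast
  then obtain K where K: "K \<in> I" "J \<subseteq> K" "K \<subseteq> B" "card K = rk I B"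
    using indep_extend[of J B] assms by blast
  then obtain L where L: "L \<in> I" "K \<subseteq> L" "L \<subseteq> insert e B" "card L = rk I (insert e B)"
    using indep_extend[of K "insert e B"] by blast
  have "e \<in> L" using L assms(2) card_le_rk[of L B] by fastforce
  then have "insert e J \<in> I" using indep_subset[OF L(1)] K L by blast
  then have "card (insert e J) \<le> rk I (insert e A)" using J by (intro card_le_rk) auto
  then show ?thesis using J \<open>e \<notin> B\<close> assms(1) indep_finite by (subst (asm) card_insert_disjoint) auto
qed

lemma rk_insert_loop:
  assumes "is_loop I e"
  shows "rk I (insert e A) = rk I A"
proof -
  have "e \<notin> J" if "J \<in> I" for J
    using assms indep_in_basis[OF that] by (auto simp: is_loop_def)
  then have "{J \<in> I. J \<subseteq> insert e A} = {J \<in> I. J \<subseteq> A}" by blast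
  then show ?thesis by (simp add: rk_def)
qed

lemma rk_insert_nonloop:
  assumes "\<not> is_loop I e"
  shows "rk I {} < rk I {e}"
proof -
  have "{e} \<in> I" using assms indep_subset unfolding is_loop_def bases_def by blast
  then have "card {e} \<le> rk I {e}" by (intro card_le_rk) auto
  moreover have "rk I {} = 0" using rk_witness[of "{}"] by auto
  ultimately show ?thesis by simp
qed

text \<open>Any basis extending a rank witness for \<open>A\<close> also contains \<open>e\<close>,
  so the witness together with \<open>e\<close> is independent.\<close>

lemma rk_insert_coloop:
  assumes "is_coloop I e" "e \<notin> A"
  shows "rk I A < rk I (insert e A)"
proof -
  obtain J where J: "J \<in> I" "J \<subseteq> A" "card J = rk I A" using rk_witness by blast
  obtain B where B: "B \<in> bases I" "J \<subseteq> B" using indep_in_basis J by blast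
  then have "insert e J \<in> I" using assms indep_subset[of B] by (auto simp: is_coloop_def bases_def)
  then have "card (insert e J) \<le> rk I (insert e A)" using J by (intro card_le_rk) auto
  then show ?thesis using J assms indep_finite by (subst (asm) card_insert_disjoint) auto
qed

text \<open>Some basis avoids \<open>e\<close>; it lies in \<open>A\<close> and already has full
  rank.\<close>

lemma rk_insert_noncoloop:
  assumes "\<not> is_coloop I e" "insert e A = E"
  shows "rk I (insert e A) = rk I A"
proof -
  obtain B where B: "B \<in> bases I" "e \<notin> B" using assms by (auto simp: is_coloop_def)
  then have "B \<in> I" "B \<subseteq> E" using assms matroid by (auto simp: matroid_on_def bases_def)
  then have "rk I E \<le> rk I A" using B assms card_basis by (metis card_le_rk subset_insert)
  moreover have "rk I A \<le> rk I E" using assms(2) by (intro rk_mono) auto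
  ultimately show ?thesis using assms(2) by simp
qed

end

lemma rk_deletion: "e \<notin> A \<Longrightarrow> rk (deletion I {e}) A = rk I A"
  unfolding rk_def deletion_def by (rule arg_cong[where f = "\<lambda>S. Max (card ` S)"]) blast

subsection \<open>Insertion of n into a permutation\<close>

lemma ins_less: "p < i \<Longrightarrow> ins n \<mu> i p = \<mu> p"
  by (simp add: ins_def)

lemma ins_same [simp]: "ins n \<mu> i i = n"
  by (simp add: ins_def)

lemma ins_Suc: "i \<le> p \<Longrightarrow> p < n \<Longrightarrow> ins n \<mu> i (Suc p) = \<mu> p"
  by (simp add: ins_def)

lemma ins_comp_transpose:
  "i < n \<Longrightarrow> ins n \<mu> i \<circ> transpose i (i + 1) = ins n \<mu> (i + 1)"
  by (rule ext) (auto simp: ins_def transpose_def)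

text \<open>Downward induction from position n, where the insertion is \<mu> itself; each smaller
  position differs by one adjacent transposition.\<close>

lemma ins_permutes:
  assumes "\<mu> permutes {1..n - 1}" "1 \<le> i" "i \<le> n"
  shows "ins n \<mu> i permutes {1..n}"
  using assms(3)
proof (induction i rule: inc_induct)
  case base
  have "\<mu> n = n" using assms by (intro permutes_not_in[OF assms(1)]) auto
  then have "ins n \<mu> n = \<mu>" by (auto simp: ins_def)
  moreover have "\<mu> permutes {1..n}" using assms(1) by (rule permutes_subset) auto
  ultimately show ?case by simp
next
  case (step j)
  have eq: "ins n \<mu> j = ins n \<mu> (Suc j) \<circ> transpose j (j + 1)"
    using ins_comp_transpose[of j n \<mu>, symmetric] step by (simp add: comp_assoc)
  have "transpose j (j + 1) permutes {1..n}"
    using step assms by (intro permutes_swap_id) auto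
  with step.IH show ?case unfolding eq by (intro permutes_compose)
qed

lemma ins_transpose_below:
  "i + 1 < j \<Longrightarrow> ins n (\<mu> \<circ> transpose i (i + 1)) j = ins n \<mu> j \<circ> transpose i (i + 1)"
  by (rule ext) (auto simp: ins_def transpose_def)

text \<open>Entries from position \<open>j\<close> on move up by one, and the transposition moves
  with them. Position \<open>j = i + 1\<close> is covered by neither form, since n then separates
  the two swapped entries.\<close>

lemma ins_transpose_above:
  "j \<le> i \<Longrightarrow> i + 1 < n \<Longrightarrow>
    ins n (\<mu> \<circ> transpose i (i + 1)) j = ins n \<mu> j \<circ> transpose (i + 1) (i + 2)"
  by (rule ext) (auto simp: ins_def transpose_def)

lemma ins_image_below: "p \<le> i \<Longrightarrow> ins n \<mu> i ` {1..<p} = \<mu> ` {1..<p}"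
  by (intro image_cong) (auto simp: ins_less)

lemma ins_image_above:
  assumes "1 \<le> i" "i \<le> p" "p \<le> n"
  shows "ins n \<mu> i ` {1..<Suc p} = insert n (\<mu> ` {1..<p})"
proof -
  have "{1..<Suc p} = insert i ({1..<i} \<union> Suc ` {i..<p})"
    using assms by (auto simp: image_Suc_atLeastLessThan)
  also have "ins n \<mu> i ` \<dots> = insert n (\<mu> ` {1..<i} \<union> \<mu> ` {i..<p})"
    using assms by (simp add: image_Un image_image ins_less ins_Suc del: image_Suc_atLeastLessThan
        cong: image_cong_simp)
  also have "\<mu> ` {1..<i} \<union> \<mu> ` {i..<p} = \<mu> ` {1..<p}"
    unfolding image_Un[symmetric] using assms by (simp add: ivl_disj_un_two)
  finally show ?thesis .
qed

subsection \<open>Greedy bases\<close>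

lemma mem_greedy_basis_iff:
  assumes "\<sigma> permutes {1..m}" "j \<in> {1..m}"
  shows "\<sigma> j \<in> greedy_basis I m \<sigma> \<longleftrightarrow> rk I (\<sigma> ` {1..<j}) < rk I (\<sigma> ` {1..<Suc j})"
  using assms permutes_inj[OF assms(1)]
  by (auto simp: greedy_basis_def atLeastLessThanSuc_atLeastAtMost inj_eq)

text \<open>For \<open>1 \<le> p \<le> n\<close> this decides whether n enters the greedy basis of
  \<open>ins n \<mu> p\<close>, since exactly the first \<open>p - 1\<close> entries of \<mu>
  precede n there.\<close>

definition raises :: "nat set set \<Rightarrow> nat \<Rightarrow> (nat \<Rightarrow> nat) \<Rightarrow> nat \<Rightarrow> bool" where
  "raises I n \<mu> p \<longleftrightarrow> rk I (\<mu> ` {1..<p}) < rk I (insert n (\<mu> ` {1..<p}))"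

lemma permutes_notin_image:
  fixes n :: nat
  assumes "\<mu> permutes {1..n - 1}" "p \<le> n" "1 \<le> n"
  shows "n \<notin> \<mu> ` {1..<p}"
proof
  assume "n \<in> \<mu> ` {1..<p}"
  then obtain q where q: "n = \<mu> q" "q \<in> {1..<p}" by (rule imageE)
  from q(2) assms(2) have "q \<in> {1..n - 1}" by auto
  with permutes_in_image[OF assms(1), of q] assms(3) q(1) show False by auto
qed

text \<open>Entries before n are tested as in the deletion. An entry after n loses its place in the
  greedy basis exactly when n raises the rank just before that entry but no longer just after it.
  The second claim makes the union disjoint, so that the product over the complement
  factors.\<close>

lemma complement_greedy_basis_ins:
  assumes M: "matroid_on E M" and \<mu>: "\<mu> permutes {1..n - 1}" and i: "1 \<le> i" "i \<le> n"
  shows "{1..n} - greedy_basis M n (ins n \<mu> i) =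
    (if raises M n \<mu> i then {} else {n}) \<union>
    ({1..n - 1} - greedy_basis (deletion M {n}) (n - 1) \<mu>) \<union>
    \<mu> ` {j. i \<le> j \<and> j < n \<and> raises M n \<mu> j \<and> \<not> raises M n \<mu> (Suc j)}"
    and "i \<le> j \<Longrightarrow> j < n \<Longrightarrow> raises M n \<mu> j \<Longrightarrow> \<not> raises M n \<mu> (Suc j) \<Longrightarrow>
      \<mu> j \<in> greedy_basis (deletion M {n}) (n - 1) \<mu>"
proof -
  let ?B = "greedy_basis M n (ins n \<mu> i)" and ?D = "greedy_basis (deletion M {n}) (n - 1) \<mu>"
  let ?J = "{j. i \<le> j \<and> j < n \<and> raises M n \<mu> j \<and> \<not> raises M n \<mu> (Suc j)}"
  note perm = ins_permutes[OF \<mu> i]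
  have n: "n \<in> ?B \<longleftrightarrow> raises M n \<mu> i"
    using mem_greedy_basis_iff[OF perm, of i M] i
    unfolding ins_image_below[OF order_refl] ins_image_above[OF i(1) order_refl i(2)] raises_def
    by simp
  have B0: "\<mu> j \<in> ?D \<longleftrightarrow> rk M (\<mu> ` {1..<j}) < rk M (\<mu> ` {1..<Suc j})" if "j \<in> {1..n - 1}" for j
  proof -
    have "n \<notin> \<mu> ` {1..<j}" "n \<notin> \<mu> ` {1..<Suc j}"
      using that i by (intro permutes_notin_image[OF \<mu>]; auto)+
    then show ?thesis using mem_greedy_basis_iff[OF \<mu> that] by (simp add: rk_deletion del: One_nat_def)
  qed
  have B: "(\<mu> j \<in> ?B \<longleftrightarrow> \<mu> j \<in> ?D \<and> j \<notin> ?J) \<and> (j \<in> ?J \<longrightarrow> \<mu> j \<in> ?D)" if j: "j \<in> {1..n - 1}" for j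
  proof (cases "j < i")
    case True
    then have "ins n \<mu> i j = \<mu> j" by (rule ins_less)
    with True i j mem_greedy_basis_iff[OF perm, of j M] B0[OF j] show ?thesis
      by (simp add: ins_image_below del: One_nat_def)
  next
    case False
    let ?A = "\<mu> ` {1..<j}"
    have "\<mu> ` {1..<Suc j} = insert (\<mu> j) ?A"
      using j by (simp add: atLeastLessThanSuc)
    moreover have "ins n \<mu> i (Suc j) = \<mu> j" using False i j by (intro ins_Suc) auto
    ultimately have B: "\<mu> j \<in> ?B \<longleftrightarrow> rk M (insert n ?A) < rk M (insert n (insert (\<mu> j) ?A))"
      and B0: "\<mu> j \<in> ?D \<longleftrightarrow> rk M ?A < rk M (insert (\<mu> j) ?A)"
      and J: "j \<in> ?J \<longleftrightarrow> rk M ?A < rk M (insert n ?A) \<and>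
        \<not> rk M (insert (\<mu> j) ?A) < rk M (insert n (insert (\<mu> j) ?A))"
      using mem_greedy_basis_iff[OF perm, of "Suc j" M] B0[OF j] False i j
        ins_image_above[of i j n \<mu>] ins_image_above[of i "Suc j" n \<mu>]
      by (auto simp: raises_def)
    \<comment> \<open>The ranks of \<open>?A\<close> with \<mu>(j), n, both or neither added satisfy
      monotonicity, unit increase and diminishing returns; both claims are linear
      consequences.\<close>
    have "rk M ?A \<le> rk M (insert (\<mu> j) ?A)" "rk M ?A \<le> rk M (insert n ?A)"
      "rk M (insert (\<mu> j) ?A) \<le> rk M (insert n (insert (\<mu> j) ?A))"
      "rk M (insert n ?A) \<le> rk M (insert n (insert (\<mu> j) ?A))"
      by (intro rk_mono[OF M]; blast)+
    moreover have "rk M (insert (\<mu> j) ?A) < rk M (insert n (insert (\<mu> j) ?A)) \<Longrightarrow>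
        rk M ?A < rk M (insert n ?A)"
      by (rule rk_insert_less_antimono[OF M]) auto
    moreover note rk_insert_le[OF M, of "\<mu> j" ?A] rk_insert_le[OF M, of n ?A]
      rk_insert_le[OF M, of n "insert (\<mu> j) ?A"]
    ultimately show ?thesis unfolding B B0 J by (intro conjI impI; linarith)
  qed
  have J_sub: "?J \<subseteq> {1..n - 1}" using i by auto
  have "{1..n} - ?B = ({n} - ?B) \<union> (\<mu> ` {1..n - 1} - ?B)"
    unfolding permutes_image[OF \<mu>] using i by auto
  also have "{n} - ?B = (if raises M n \<mu> i then {} else {n})" using n by auto
  also have "\<mu> ` {1..n - 1} - ?B = (\<mu> ` {1..n - 1} - ?D) \<union> \<mu> ` ?J"
    using B J_sub by blast
  finally show "{1..n} - ?B = (if raises M n \<mu> i then {} else {n}) \<union> ({1..n - 1} - ?D) \<union> \<mu> ` ?J"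
    unfolding permutes_image[OF \<mu>] Un_assoc .
  show "\<mu> j \<in> ?D" if "i \<le> j" "j < n" "raises M n \<mu> j" "\<not> raises M n \<mu> (Suc j)"
    using B[of j] that i by simp
qed

section \<open>Positions at which n raises the rank\<close>

lemma raises_antimono:
  "matroid_on E M \<Longrightarrow> p \<le> q \<Longrightarrow> raises M n \<mu> q \<Longrightarrow> raises M n \<mu> p"
  unfolding raises_def by (rule rk_insert_less_antimono) auto

lemma raises_coloop:
  assumes "matroid_on E M" "is_coloop M n" "\<mu> permutes {1..n - 1}" "p \<le> n" "1 \<le> n"
  shows "raises M n \<mu> p"
  unfolding raises_def
  by (rule rk_insert_coloop[OF assms(1,2) permutes_notin_image[OF assms(3-5)]])

lemma not_raises_loop: "matroid_on E M \<Longrightarrow> is_loop M n \<Longrightarrow> \<not> raises M n \<mu> p"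
  by (simp add: raises_def rk_insert_loop)

text \<open>These positions are closed downwards, contain 1 because n is not a loop, and omit n
  because n is not a coloop; \<open>k_index\<close> is the last of them.\<close>

lemma k_index:
  assumes M: "matroid_on {1..n} M" and nc: "\<not> is_coloop M n" and nl: "\<not> is_loop M n"
    and \<mu>: "\<mu> permutes {1..n - 1}" and n: "1 \<le> n"
  shows "1 \<le> k_index M n \<mu>" "k_index M n \<mu> < n"
    and "p \<le> n \<Longrightarrow> raises M n \<mu> p \<longleftrightarrow> p \<le> k_index M n \<mu>"
proof -
  let ?S = "{i \<in> {1..<n}. raises M n \<mu> i}"
  have one: "raises M n \<mu> 1" using rk_insert_nonloop[OF M nl] by (simp add: raises_def)
  have "{1..<n} = {1..n - 1}" by auto
  then have "insert n (\<mu> ` {1..<n}) = {1..n}"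
    using permutes_image[OF \<mu>] n by auto
  then have last: "\<not> raises M n \<mu> n" using rk_insert_noncoloop[OF M nc] by (simp add: raises_def)
  \<comment> \<open>On a one-element ground set the element is a loop or a coloop; excluding
    \<open>n = 1\<close> makes the set under the maximum nonempty.\<close>
  have "n \<noteq> 1" using one last by metis
  then have "1 \<in> ?S" using one n by auto
  then have "finite ?S" "?S \<noteq> {}" by auto
  then have Max: "Max ?S \<in> ?S" by (rule Max_in)
  have k: "k_index M n \<mu> = Max ?S" by (simp add: k_index_def raises_def)
  show "1 \<le> k_index M n \<mu>" "k_index M n \<mu> < n" using Max unfolding k by auto
  show "raises M n \<mu> p \<longleftrightarrow> p \<le> k_index M n \<mu>" if "p \<le> n"
  proof
    assume r: "raises M n \<mu> p"
    with last that have "p < n" by (cases "p = n") auto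
    show "p \<le> k_index M n \<mu>"
    proof (cases "p = 0")
      case False
      with r \<open>p < n\<close> have "p \<in> ?S" by auto
      then show ?thesis unfolding k by (intro Max_ge) auto
    qed simp
  next
    assume "p \<le> k_index M n \<mu>"
    with raises_antimono[OF M] Max show "raises M n \<mu> p" unfolding k by blast
  qed
qed

subsection \<open>Summation by parts\<close>

lemma sum_by_parts:
  fixes G A :: "nat \<Rightarrow> 'a :: comm_ring"
  assumes "1 \<le> n"
  shows "(\<Sum>i\<in>{1..n}. G i * (A i - A (i - 1))) =
    G n * A n - G 1 * A 0 + (\<Sum>j\<in>{1..<n}. A j * (G j - G (j + 1)))"
  using assms by (induction n rule: dec_induct) (simp_all add: algebra_simps)

context
  fixes F g y A :: "nat \<Rightarrow> 'a :: field" and x :: 'a and n :: nat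
  assumes n: "1 \<le> n"
    and A: "A 0 = 0" "A n = 1" "\<And>j. j \<in> {1..<n} \<Longrightarrow> A j = x / (x - y j)"
    and neq: "\<And>j. j \<in> {1..<n} \<Longrightarrow> x \<noteq> y j"
    and diff: "\<And>j. j \<in> {1..<n} \<Longrightarrow> F j - F (j + 1) = (x - y j) * g j"
begin

lemma sum_increments: "(\<Sum>i\<in>{1..n}. F i * (A i - A (i - 1))) = F n + (\<Sum>j\<in>{1..<n}. x * g j)"
proof -
  have "A j * (F j - F (j + 1)) = x * g j" if "j \<in> {1..<n}" for j
    using A(3)[OF that] diff[OF that] neq[OF that] by simp
  then have "(\<Sum>j\<in>{1..<n}. A j * (F j - F (j + 1))) = (\<Sum>j\<in>{1..<n}. x * g j)"
    by (rule sum.cong[OF refl])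
  with sum_by_parts[OF n, of F A] A show ?thesis by simp
qed

lemma sum_increments_split:
  assumes k: "1 \<le> k" "k < n"
  shows "(\<Sum>i\<in>{1..n}. F i * (A i - A (i - 1)) * (if i \<le> k then 1 - y k else 1 - x)) =
    F n + (\<Sum>j\<in>{1..<n}. x * (1 - y (max j k)) * g j)"
proof -
  define c where "c i = (if i \<le> k then 1 - y k else 1 - x)" for i
  \<comment> \<open>This telescoping correction accounts for the change of weight from
    \<open>1 - y k\<close> to \<open>1 - x\<close> after position \<open>k\<close>, and for the use
    of \<open>1 - y j\<close> instead of \<open>1 - x\<close> beyond it.\<close>
  define H where "H j = (if j \<le> k then 0 else x * F j)" for j
  have "A j * (F j * c j - F (j + 1) * c (j + 1)) =
      x * (1 - y (max j k)) * g j + (H (Suc j) - H j)" if j: "j \<in> {1..<n}" for j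
  proof -
    have F: "F j = F (j + 1) + (x - y j) * g j" using diff[OF j] by (simp add: algebra_simps)
    have A': "A j * (x - y j) = x" using A(3)[OF j] neq[OF j] by simp
    consider "j < k" | "j = k" | "k < j" by linarith
    then show ?thesis
    proof cases
      case 1
      have "A j * (F j * c j - F (j + 1) * c (j + 1)) = A j * (x - y j) * g j * (1 - y k)"
        using 1 by (simp add: c_def F algebra_simps)
      then show ?thesis using 1 unfolding A' by (simp add: H_def max_def)
    next
      case 2
      then have c: "c j = 1 - y j" "c (j + 1) = 1 - x" by (simp_all add: c_def)
      have "A j * (F j * c j - F (j + 1) * c (j + 1)) =
          A j * (x - y j) * (g j * (1 - y j) + F (j + 1))"
        unfolding c F by (simp add: algebra_simps)
      then show ?thesis using 2 unfolding A' by (simp add: H_def algebra_simps)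
    next
      case 3
      have "A j * (F j * c j - F (j + 1) * c (j + 1)) = A j * (x - y j) * g j * (1 - x)"
        using 3 by (simp add: c_def F algebra_simps)
      then show ?thesis using 3 unfolding A' by (simp add: H_def max_def F algebra_simps)
    qed
  qed
  then have "(\<Sum>j\<in>{1..<n}. A j * (F j * c j - F (j + 1) * c (j + 1))) =
      (\<Sum>j\<in>{1..<n}. x * (1 - y (max j k)) * g j) + (\<Sum>j\<in>{1..<n}. H (Suc j) - H j)"
    unfolding sum.distrib[symmetric] by (rule sum.cong[OF refl])
  \<comment> \<open>The total \<open>x * F n\<close> completes the boundary term
    \<open>F n * (1 - x)\<close> to \<open>F n\<close>.\<close>
  also have "(\<Sum>j\<in>{1..<n}. H (Suc j) - H j) = x * F n"
    using k by (subst sum_Suc_diff') (auto simp: H_def)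
  finally have "(\<Sum>i\<in>{1..n}. F i * c i * (A i - A (i - 1))) =
      F n * c n + (\<Sum>j\<in>{1..<n}. x * (1 - y (max j k)) * g j) + x * F n"
    using sum_by_parts[OF n, of "\<lambda>i. F i * c i" A] A by simp
  then show ?thesis using k unfolding c_def by (simp add: algebra_simps)
qed

end

text \<open>Changing \<open>F\<close> at \<open>i + 1\<close> alone affects only the quotients at
  \<open>i\<close> and \<open>i + 1\<close>. With equal weights and equal \<open>Y\<close> there,
  only their sum matters, and it is determined by \<open>F i - F (i + 2)\<close>.\<close>

lemma sum_diff_quotients_transpose_eq:
  fixes F F' g g' Y Y' W :: "nat \<Rightarrow> 'a :: idom"
  assumes i: "i \<in> {1..<n - 1}"
    and F: "\<And>j. j \<in> {1..n} \<Longrightarrow> j \<noteq> i + 1 \<Longrightarrow> F j = F' j"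
    and g: "\<And>j. j \<in> {1..<n} \<Longrightarrow> F j - F (j + 1) = (x - Y j) * g j"
    and g': "\<And>j. j \<in> {1..<n} \<Longrightarrow> F' j - F' (j + 1) = (x - Y j) * g' j"
    and neq: "\<And>j. j \<in> {1..<n} \<Longrightarrow> x \<noteq> Y j"
    and Y: "Y i = Y (i + 1)" and W: "W i = W (i + 1)"
  shows "(\<Sum>j\<in>{1..<n}. W j * g j) = (\<Sum>j\<in>{1..<n}. W j * g' j)"
proof -
  let ?S = "{1..<n} - {i, i + 1}"
  have split: "(\<Sum>j\<in>{1..<n}. W j * p j) = W i * (p i + p (i + 1)) + (\<Sum>j\<in>?S. W j * p j)" for p
  proof -
    have "{1..<n} = insert i (insert (i + 1) ?S)" using i by auto
    then have "(\<Sum>j\<in>{1..<n}. W j * p j) = (\<Sum>j\<in>insert i (insert (i + 1) ?S). W j * p j)" by simp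
    also have "\<dots> = W i * (p i + p (i + 1)) + (\<Sum>j\<in>?S. W j * p j)"
      using W by (subst sum.insert; simp add: distrib_left)
    finally show ?thesis .
  qed
  have "g j = g' j" if "j \<in> ?S" for j
  proof -
    have "(x - Y j) * g j = (x - Y j) * g' j"
      using that g[of j] g'[of j] F[of j] F[of "j + 1"] by auto
    with neq[of j] that show ?thesis by simp
  qed
  then have S: "(\<Sum>j\<in>?S. W j * g j) = (\<Sum>j\<in>?S. W j * g' j)" by simp
  have "(x - Y i) * (g i + g (i + 1)) = (F i - F (i + 1)) + (F (i + 1) - F (i + 1 + 1))"
    using i by (subst (1 2) g) (auto simp: Y distrib_left)
  also have "\<dots> = (F' i - F' (i + 1)) + (F' (i + 1) - F' (i + 1 + 1))"
    using F[of i] F[of "i + 1 + 1"] i by auto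
  also have "\<dots> = (x - Y i) * (g' i + g' (i + 1))"
    using i by (subst (1 2) g') (auto simp: Y distrib_left)
  finally have "(x - Y i) * (g i + g (i + 1)) = (x - Y i) * (g' i + g' (i + 1))" .
  moreover have "x \<noteq> Y i" using i by (intro neq) auto
  ultimately have "g i + g (i + 1) = g' i + g' (i + 1)" by simp
  with S show ?thesis unfolding split by simp
qed

subsection \<open>Cone generating functions\<close>

text \<open>This is the interior case of the cone computation: inserting x between neighbours y and
  z replaces the factor on the right by the first two on the left.\<close>

lemma cross_ratio_cancel:
  fixes x y z :: "'a :: field"
  assumes "x \<noteq> y" "x \<noteq> z" "x \<noteq> 0" "y \<noteq> 0"
  shows "(1 - x / y) * (1 - z / x) * (x / (x - z) - x / (x - y)) = 1 - z / y"
proof -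
  define u v where "u = x - y" and "v = x - z"
  have uv: "u \<noteq> 0" "v \<noteq> 0" using assms by (auto simp: u_def v_def)
  have "1 - x / y = - u / y" "1 - z / x = v / x" "1 - z / y = (v - u) / y"
    using assms by (simp_all add: u_def v_def diff_divide_distrib)
  moreover have "- u / y * (v / x) * (x / v - x / u) = (v - u) / y"
    using uv assms by (simp add: field_simps)
  ultimately show ?thesis by (simp add: u_def v_def)
qed

text \<open>Only the factors adjacent to n change. The values of \<open>A\<close> at 0 and
  \<open>n\<close> give the insertions at either end the same form as the interior ones.\<close>

lemma Q_cone_ins:
  assumes \<mu>: "\<mu> permutes {1..n - 1}" and i: "1 \<le> i" "i \<le> n"
    and y: "\<And>j. y j = laurent_fract (lvar (\<mu> j))" and x: "x = laurent_fract (lvar n)"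
    and A: "A 0 = 0" "A n = 1" "\<And>j. j \<in> {1..<n} \<Longrightarrow> A j = x / (x - y j)"
  shows "Q_cone n (ins n \<mu> i) = Q_cone (n - 1) \<mu> * (A i - A (i - 1))"
proof -
  define l m where "l = i - 1" and "m = n - 1"
  then have lm: "i = Suc l" "n = Suc m" "l \<le> m" using i by auto
  define z where "z p = laurent_fract (lvar (ins n \<mu> i p))" for p
  define den where "den = (\<Prod>p\<in>{1..<n}. 1 - z (p + 1) / z p)"
  define den0 where "den0 = (\<Prod>p\<in>{1..<m}. 1 - y (p + 1) / y p)"
  have z: "z i = x" "\<And>p. p < i \<Longrightarrow> z p = y p" "\<And>p. i \<le> p \<Longrightarrow> p < n \<Longrightarrow> z (Suc p) = y p"
    by (simp_all add: z_def x y ins_less ins_Suc)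
  have nz: "y p \<noteq> 0" "x \<noteq> 0" for p by (simp_all add: y x)
  have xy: "x \<noteq> y p" if "p \<in> {1..m}" for p
    using permutes_in_image[OF \<mu>, of p] that lm by (auto simp: x y)
  have den0: "den0 \<noteq> 0"
    using permutes_inj[OF \<mu>] by (auto simp: den0_def y field_simps inj_eq)
  have z_neq: "z (p + 1) \<noteq> z p" "z p \<noteq> 0" for p
    using permutes_inj[OF ins_permutes[OF \<mu> i]] by (simp_all add: z_def inj_eq)
  have den: "den \<noteq> 0"
    using z_neq(1)[symmetric] z_neq(2) by (auto simp: den_def field_simps)
  have right: "(\<Prod>p\<in>{Suc i..<n}. 1 - z (p + 1) / z p) = (\<Prod>p\<in>{i..<m}. 1 - y (p + 1) / y p)"
    unfolding lm(2) prod.shift_bounds_Suc_ivl using lm by (intro prod.cong) (auto simp: z)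
  have left: "(\<Prod>p\<in>{1..<l}. 1 - z (p + 1) / z p) = (\<Prod>p\<in>{1..<l}. 1 - y (p + 1) / y p)"
    using lm by (intro prod.cong) (auto simp: z)
  have "den * (A i - A (i - 1)) = den0"
  \<comment> \<open>There are \<open>l\<close> entries before n, out of \<open>m\<close>: n comes
    first if \<open>l = 0\<close>, last if \<open>l = m\<close>, and otherwise has two
    neighbours.\<close>
  proof (cases "l = 0")
    case True
    show ?thesis
    proof (cases "m = 0")
      case True
      with \<open>l = 0\<close> lm A show ?thesis by (simp add: den_def den0_def)
    next
      case False
      have "den = (1 - y 1 / x) * den0"
        using False True lm right z unfolding den_def den0_def
        by (subst prod.atLeast_Suc_lessThan) auto
      moreover have "(1 - y 1 / x) * (x / (x - y 1)) = 1"
        using xy[of 1] nz False by (simp add: field_simps)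
      moreover have "A i - A (i - 1) = x / (x - y 1)"
        using True False lm A(1) A(3)[of 1] by simp
      ultimately show ?thesis by (simp add: mult_ac)
    qed
  next
    case False
    show ?thesis
    proof (cases "l = m")
      case True
      have "den = den0 * (1 - x / y m)"
        using False True lm left z unfolding den_def den0_def
        by (simp add: prod.atLeastLessThan_Suc)
      moreover have "(1 - x / y m) * (1 - x / (x - y m)) = 1"
        using xy[of m] nz False True by (simp add: field_simps)
      moreover have "A i - A (i - 1) = 1 - x / (x - y m)"
        using True False lm A(2) A(3)[of m] by simp
      ultimately show ?thesis by (simp add: mult_ac)
    next
      case l: False
      let ?L = "\<Prod>p\<in>{1..<l}. 1 - y (p + 1) / y p" and ?R = "\<Prod>p\<in>{i..<m}. 1 - y (p + 1) / y p"
      have "den = ?L * (\<Prod>p\<in>{l..<n}. 1 - z (p + 1) / z p)"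
        unfolding den_def left[symmetric] using l False lm
        by (intro prod.atLeastLessThan_concat[symmetric]) auto
      also have "(\<Prod>p\<in>{l..<n}. 1 - z (p + 1) / z p) =
          (1 - z (l + 1) / z l) * (\<Prod>p\<in>{i..<n}. 1 - z (p + 1) / z p)"
        unfolding lm(1) using l lm by (intro prod.atLeast_Suc_lessThan) auto
      also have "(\<Prod>p\<in>{i..<n}. 1 - z (p + 1) / z p) = (1 - z (i + 1) / z i) * ?R"
        unfolding right[symmetric] using l lm by (intro prod.atLeast_Suc_lessThan) auto
      also have "z (l + 1) = x" using z lm by simp
      also have "z l = y l" using z lm by simp
      also have "z (i + 1) = y i" using z l lm by simp
      also have "z i = x" using z by simp
      finally have "den = ?L * (1 - x / y l) * (1 - y i / x) * ?R" by (simp add: mult_ac)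
      moreover have "den0 = ?L * (\<Prod>p\<in>{l..<m}. 1 - y (p + 1) / y p)"
        unfolding den0_def using l False lm
        by (intro prod.atLeastLessThan_concat[symmetric]) auto
      then have "den0 = ?L * (1 - y i / y l) * ?R"
        using l lm prod.atLeast_Suc_lessThan[of l m "\<lambda>p. 1 - y (p + 1) / y p"] by (simp add: mult_ac)
      moreover have "(1 - x / y l) * (1 - y i / x) * (x / (x - y i) - x / (x - y l)) = 1 - y i / y l"
        using xy[of l] xy[of i] nz False l lm by (intro cross_ratio_cancel) auto
      moreover have "A i = x / (x - y i)" "A (i - 1) = x / (x - y l)"
        using A(3)[of i] A(3)[of l] False l lm by auto
      ultimately show ?thesis by (simp add: mult_ac)
    qed
  qed
  then have "1 / den = 1 / den0 * (A i - A (i - 1))"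
    using den den0 by (simp add: field_simps)
  then show ?thesis
    by (simp add: Q_cone_def den_def den0_def z_def y m_def)
qed

subsection \<open>The pushed forward family\<close>

text \<open>The index \<open>max j k\<close> merges the two sums of the definition into one, which
  then combines with \<open>h_poly\<close> term by term.\<close>

lemma push_family_neither:
  assumes "\<not> is_coloop M n" "\<not> is_loop M n" "k_index M n \<mu> < n"
  shows "push_family M n f \<mu> = f (ins n \<mu> n) +
    (\<Sum>j\<in>{1..<n}. lvar n * (1 - lvar (\<mu> (max j (k_index M n \<mu>)))) * g_poly n f \<mu> j)"
proof -
  let ?k = "k_index M n \<mu>" and ?g = "g_poly n f \<mu>"
  have "{1..<n} = {1..?k} \<union> {?k + 1..<n}" using assms(3) by auto
  then have "(\<Sum>j\<in>{1..<n}. lvar (\<mu> (max j ?k)) * ?g j) =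
      (\<Sum>j\<in>{1..?k}. lvar (\<mu> (max j ?k)) * ?g j) + (\<Sum>j\<in>{?k + 1..<n}. lvar (\<mu> (max j ?k)) * ?g j)"
    by (simp only:) (rule sum.union_disjoint; auto)
  also have "(\<Sum>j\<in>{1..?k}. lvar (\<mu> (max j ?k)) * ?g j) = (\<Sum>j\<in>{1..?k}. lvar (\<mu> ?k) * ?g j)"
    by (intro sum.cong) (auto simp: max_def)
  also have "(\<Sum>j\<in>{?k + 1..<n}. lvar (\<mu> (max j ?k)) * ?g j) = (\<Sum>j\<in>{?k + 1..<n}. lvar (\<mu> j) * ?g j)"
    by (intro sum.cong) (auto simp: max_def)
  finally have "push_family M n f \<mu> = h_poly n f \<mu> - lvar n * (\<Sum>j\<in>{1..<n}. lvar (\<mu> (max j ?k)) * ?g j)"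
    using assms by (simp add: push_family_def Let_def)
  then show ?thesis
    by (simp add: h_poly_def sum_distrib_left algebra_simps sum_subtractf)
qed

context
  fixes n :: nat and f :: "(nat \<Rightarrow> nat) \<Rightarrow> laurent"
  assumes n: "1 \<le> n" and f: "f \<in> PLaur n"
begin

lemma Laurent_family: "\<sigma> permutes {1..n} \<Longrightarrow> f \<sigma> \<in> Laurent n"
  using f by (simp add: PLaur_def piecewise_Laurent_def)

lemma Laurent_dvd_family:
  "\<sigma> permutes {1..n} \<Longrightarrow> i \<in> {1..<n} \<Longrightarrow>
    Laurent_dvd n (lvar (\<sigma> i) - lvar (\<sigma> (i + 1))) (f \<sigma> - f (\<sigma> \<circ> transpose i (i + 1)))"
  using f by (simp add: PLaur_def piecewise_Laurent_def)

lemma permutes_lvar_neq: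
  assumes "\<mu> permutes {1..n - 1}" "j \<in> {1..<n}"
  shows "\<mu> j \<in> {1..<n}" "lvar n \<noteq> lvar (\<mu> j)"
proof -
  have "\<mu> j \<in> {1..n - 1}" using permutes_in_image[OF assms(1), of j] assms(2) by auto
  then show "\<mu> j \<in> {1..<n}" "lvar n \<noteq> lvar (\<mu> j)" by auto
qed

lemma g_poly:
  assumes \<mu>: "\<mu> permutes {1..n - 1}" and j: "j \<in> {1..<n}"
  shows "g_poly n f \<mu> j \<in> Laurent n"
    and "f (ins n \<mu> j) - f (ins n \<mu> (j + 1)) = (lvar n - lvar (\<mu> j)) * g_poly n f \<mu> j"
proof -
  have "ins n \<mu> j permutes {1..n}" using \<mu> j by (intro ins_permutes) auto
  moreover have "ins n \<mu> j \<circ> transpose j (j + 1) = ins n \<mu> (j + 1)" "ins n \<mu> j (j + 1) = \<mu> j"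
    using j ins_comp_transpose[of j n \<mu>] by (simp_all add: ins_Suc)
  ultimately have "Laurent_dvd n (lvar n - lvar (\<mu> j)) (f (ins n \<mu> j) - f (ins n \<mu> (j + 1)))"
    using Laurent_dvd_family[OF _ j, of "ins n \<mu> j"] by simp
  moreover have "lvar n - lvar (\<mu> j) \<noteq> 0" using permutes_lvar_neq[OF \<mu> j] by simp
  ultimately show "g_poly n f \<mu> j \<in> Laurent n"
    "f (ins n \<mu> j) - f (ins n \<mu> (j + 1)) = (lvar n - lvar (\<mu> j)) * g_poly n f \<mu> j"
    unfolding g_poly_def by (rule Laurent_quot)+
qed

lemma Laurent_push_family:
  assumes M: "matroid_on {1..n} M" and \<mu>: "\<mu> permutes {1..n - 1}"
  shows "push_family M n f \<mu> \<in> Laurent n"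
proof -
  have F: "f (ins n \<mu> n) \<in> Laurent n" using n by (intro Laurent_family ins_permutes[OF \<mu>]) auto
  have x: "lvar n \<in> Laurent n" using n by (intro Laurent_lvar) auto
  have h: "h_poly n f \<mu> \<in> Laurent n"
    unfolding h_poly_def using F x g_poly(1)[OF \<mu>] by (intro Laurent_intros) auto
  consider "is_coloop M n" | "\<not> is_coloop M n" "is_loop M n" | "\<not> is_coloop M n" "\<not> is_loop M n"
    by blast
  then show ?thesis
  proof cases
    case 1
    with h show ?thesis by (simp add: push_family_def)
  next
    case 2
    with h x show ?thesis by (simp add: push_family_def Laurent_mult Laurent_diff)
  next
    case 3
    note k = k_index[OF M 3 \<mu> n]
    have "lvar (\<mu> (max j (k_index M n \<mu>))) \<in> Laurent n" if "j \<in> {1..<n}" for j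
    proof (rule Laurent_lvar)
      have "max j (k_index M n \<mu>) \<in> {1..<n}" using that k by auto
      from permutes_lvar_neq(1)[OF \<mu> this] show "\<mu> (max j (k_index M n \<mu>)) \<in> {1..n}" by auto
    qed
    then show ?thesis unfolding push_family_neither[OF 3 k(2)]
      using F x g_poly(1)[OF \<mu>] by (intro Laurent_add Laurent_sum Laurent_mult Laurent_diff) auto
  qed
qed

subsection \<open>Divisibility\<close>

context
  fixes \<mu> \<mu>' :: "nat \<Rightarrow> nat" and i :: nat and S :: "laurent \<Rightarrow> laurent"
  assumes \<mu>: "\<mu> permutes {1..n - 1}" and i: "i \<in> {1..<n - 1}"
  defines "\<mu>' \<equiv> \<mu> \<circ> transpose i (i + 1)" and "S \<equiv> subst_var (\<mu> i) (\<mu> (i + 1))"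
begin

lemma permutes_transposed: "\<mu>' permutes {1..n - 1}"
  unfolding \<mu>'_def using i by (intro permutes_compose[OF _ \<mu>] permutes_swap_id) auto

lemma transposed_in_range: "\<mu> i \<in> {1..<n}" "\<mu> (i + 1) \<in> {1..<n}"
  using i by (intro permutes_lvar_neq(1)[OF \<mu>]; auto)+

lemma subst_lvar_n: "S (lvar n) = lvar n"
  using transposed_in_range(2) by (auto simp: S_def)

lemma subst_lvar_perm: "S (lvar (\<mu> j)) = lvar (\<mu> (if j = i + 1 then i else j))"
  using permutes_inj[OF \<mu>] by (simp add: S_def inj_eq)

lemma subst_lvar_transposed: "S (lvar (\<mu>' j)) = S (lvar (\<mu> j))"
  unfolding \<mu>'_def comp_def by (auto simp: subst_lvar_perm transpose_def)

lemma subst_family_eq: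
  assumes \<sigma>: "\<sigma> permutes {1..n}" and q: "q \<in> {1..<n}"
    and "\<sigma> q = \<mu> i" "\<sigma> (q + 1) = \<mu> (i + 1)"
  shows "S (f \<sigma>) = S (f (\<sigma> \<circ> transpose q (q + 1)))"
proof -
  let ?\<sigma>' = "\<sigma> \<circ> transpose q (q + 1)"
  have "transpose q (q + 1) permutes {1..n}" using q by (intro permutes_swap_id) auto
  from permutes_compose[OF this \<sigma>] have mem: "f \<sigma> - f ?\<sigma>' \<in> Laurent n"
    using \<sigma> by (intro Laurent_diff Laurent_family)
  have "\<mu> i \<in> {1..n}" "\<mu> (i + 1) \<in> {1..n}" using transposed_in_range by auto
  from Laurent_dvd_lvar_diff_iff[OF this mem] have "S (f \<sigma> - f ?\<sigma>') = 0"
    using Laurent_dvd_family[OF \<sigma> q] assms(3,4) by (simp add: S_def)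
  then show ?thesis by (simp add: S_def subst_var_diff)
qed

text \<open>Unless n is put between them, the two swapped entries stay adjacent after the insertion,
  so the divisibility condition on \<open>f\<close> applies to them.\<close>

lemma subst_insertions_eq:
  assumes j: "j \<in> {1..n}" "j \<noteq> i + 1"
  shows "S (f (ins n \<mu> j)) = S (f (ins n \<mu>' j))"
proof (cases "j \<le> i")
  case True
  have "i + 1 < n" using i by auto
  with ins_transpose_above[OF True this]
  have eq: "ins n \<mu>' j = ins n \<mu> j \<circ> transpose (i + 1) (i + 1 + 1)"
    unfolding \<mu>'_def by simp
  show ?thesis unfolding eq
    using True i j by (intro subst_family_eq ins_permutes[OF \<mu>]) (auto simp: ins_Suc)
next
  case False
  have eq: "ins n \<mu>' j = ins n \<mu> j \<circ> transpose i (i + 1)"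
    unfolding \<mu>'_def using False j by (intro ins_transpose_below) auto
  show ?thesis unfolding eq
    using False i j by (intro subst_family_eq ins_permutes[OF \<mu>]) (auto simp: ins_less)
qed

text \<open>Only at position \<open>i + 1\<close> may the images of the two insertions differ; that
  value cancels from the sum of the two quotients involving it.\<close>

lemma subst_weighted_sum_eq:
  assumes "W i = W (i + 1)"
  shows "(\<Sum>j\<in>{1..<n}. W j * S (g_poly n f \<mu> j)) = (\<Sum>j\<in>{1..<n}. W j * S (g_poly n f \<mu>' j))"
proof (rule sum_diff_quotients_transpose_eq[where i = i and x = "lvar n" and Y = "\<lambda>j. S (lvar (\<mu> j))"
      and F = "\<lambda>j. S (f (ins n \<mu> j))" and F' = "\<lambda>j. S (f (ins n \<mu>' j))"])
  fix j assume j: "j \<in> {1..<n}"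
  show "S (f (ins n \<mu> j)) - S (f (ins n \<mu> (j + 1))) = (lvar n - S (lvar (\<mu> j))) * S (g_poly n f \<mu> j)"
    using arg_cong[OF g_poly(2)[OF \<mu> j], of S] subst_lvar_n
    by (simp add: S_def subst_var_diff subst_var_mult)
  show "S (f (ins n \<mu>' j)) - S (f (ins n \<mu>' (j + 1))) = (lvar n - S (lvar (\<mu> j))) * S (g_poly n f \<mu>' j)"
    using arg_cong[OF g_poly(2)[OF permutes_transposed j], of S] subst_lvar_n subst_lvar_transposed[of j]
    by (simp add: S_def subst_var_diff subst_var_mult)
  have "(if j = i + 1 then i else j) \<in> {1..<n}" using i j by auto
  then show "lvar n \<noteq> S (lvar (\<mu> j))" unfolding subst_lvar_perm by (intro permutes_lvar_neq(2)[OF \<mu>])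
qed (use i assms subst_insertions_eq in \<open>auto simp: subst_lvar_perm\<close>)

lemma subst_h_poly_eq: "S (h_poly n f \<mu>) = S (h_poly n f \<mu>')"
proof -
  have "S (f (ins n \<mu> n)) = S (f (ins n \<mu>' n))" using i n by (intro subst_insertions_eq) auto
  then show ?thesis using subst_weighted_sum_eq[of "\<lambda>_. lvar n"] subst_lvar_n
    by (simp add: h_poly_def S_def subst_var_hom)
qed

text \<open>The two permutations have the same sets of initial entries except for length
  \<open>i\<close>, so only the rank test at position \<open>i + 1\<close> can change.\<close>

lemma k_index_transposed:
  assumes "matroid_on {1..n} M" "\<not> is_coloop M n" "\<not> is_loop M n"
  shows "k_index M n \<mu> = k_index M n \<mu>' \<or> {k_index M n \<mu>, k_index M n \<mu>'} \<subseteq> {i, i + 1}"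
proof -
  let ?k = "k_index M n \<mu>" and ?k' = "k_index M n \<mu>'"
  have raises_iff: "raises M n \<mu> p \<longleftrightarrow> raises M n \<mu>' p" if "p \<noteq> i + 1" for p
  proof -
    have "\<mu>' ` {1..<p} = \<mu> ` {1..<p}"
    proof (cases "p \<le> i")
      case True
      then show ?thesis unfolding \<mu>'_def by (intro image_cong) auto
    next
      case False
      then have "transpose i (i + 1) permutes {1..<p}" using that i by (intro permutes_swap_id) auto
      then show ?thesis unfolding \<mu>'_def image_comp[symmetric] by (simp only: permutes_image)
    qed
    then show ?thesis by (simp add: raises_def)
  qed
  have iff: "p \<le> ?k \<longleftrightarrow> p \<le> ?k'" if "p \<noteq> i + 1" "p \<le> n" for p
    using that raises_iff[of p] k_index(3)[OF assms \<mu> n, of p]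
      k_index(3)[OF assms permutes_transposed n, of p] by simp
  have "?k < n" "?k' < n"
    using k_index(2)[OF assms \<mu> n] k_index(2)[OF assms permutes_transposed n] .
  \<comment> \<open>Thresholds \<open>a < b\<close> disagree at both \<open>p = b\<close> and
    \<open>p = a + 1\<close>, so both of these must be the exceptional position.\<close>
  moreover have "a = i \<and> b = i + 1"
    if "a < b" "b < n" "\<And>p. p \<noteq> i + 1 \<Longrightarrow> p \<le> n \<Longrightarrow> p \<le> a \<longleftrightarrow> p \<le> b" for a b
    using that(1,2) that(3)[of b] that(3)[of "a + 1"] by (cases "b = i + 1"; cases "a = i") auto
  from this[of ?k ?k'] this[of ?k' ?k] have "?k < ?k' \<Longrightarrow> ?k' < n \<Longrightarrow> ?k = i \<and> ?k' = i + 1"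
    "?k' < ?k \<Longrightarrow> ?k < n \<Longrightarrow> ?k' = i \<and> ?k = i + 1"
    using iff by blast+
  ultimately show ?thesis by (cases ?k ?k' rule: linorder_cases) auto
qed

lemma subst_push_family_eq:
  assumes M: "matroid_on {1..n} M"
  shows "S (push_family M n f \<mu>) = S (push_family M n f \<mu>')"
proof -
  consider "is_coloop M n" | "\<not> is_coloop M n" "is_loop M n" | "\<not> is_coloop M n" "\<not> is_loop M n"
    by blast
  then show ?thesis
  proof cases
    case 1
    then show ?thesis by (simp add: push_family_def subst_h_poly_eq)
  next
    case 2
    then show ?thesis using subst_h_poly_eq by (simp add: push_family_def S_def subst_var_mult)
  next
    case 3
    let ?k = "k_index M n \<mu>" and ?k' = "k_index M n \<mu>'"
    let ?W = "\<lambda>j. lvar n * (1 - S (lvar (\<mu> (max j ?k))))"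
    \<comment> \<open>If the thresholds differ, both lie in \<open>{i, i + 1}\<close>, and
      \<open>S\<close> identifies the variables at these two positions.\<close>
    have W': "?W j = lvar n * (1 - S (lvar (\<mu>' (max j ?k'))))" for j
      using k_index_transposed[OF M 3] unfolding subst_lvar_transposed
      by (auto simp: subst_lvar_perm max_def)
    have "S (push_family M n f \<mu>) = S (f (ins n \<mu> n)) + (\<Sum>j\<in>{1..<n}. ?W j * S (g_poly n f \<mu> j))"
      unfolding push_family_neither[OF 3 k_index(2)[OF M 3 \<mu> n]]
      using subst_lvar_n by (simp add: S_def subst_var_hom)
    also have "S (f (ins n \<mu> n)) = S (f (ins n \<mu>' n))" using i n by (intro subst_insertions_eq) auto
    also have "(\<Sum>j\<in>{1..<n}. ?W j * S (g_poly n f \<mu> j)) = (\<Sum>j\<in>{1..<n}. ?W j * S (g_poly n f \<mu>' j))"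
    proof (rule subst_weighted_sum_eq)
      \<comment> \<open>Either the threshold is at least \<open>i + 1\<close> and gives both
        weights, or the weights use the two identified variables.\<close>
      have "max i ?k = max (i + 1) ?k \<or> max i ?k = i \<and> max (i + 1) ?k = i + 1" by auto
      then show "?W i = ?W (i + 1)" by (auto simp: subst_lvar_perm)
    qed
    also have "S (f (ins n \<mu>' n)) + \<dots> = S (push_family M n f \<mu>')"
      unfolding W' push_family_neither[OF 3 k_index(2)[OF M 3 permutes_transposed n]]
      using subst_lvar_n by (simp add: S_def subst_var_hom)
    finally show ?thesis .
  qed
qed

end

lemma push_family_in_PLaur_tensor:
  assumes M: "matroid_on {1..n} M"
  shows "push_family M n f \<in> PLaur_tensor n"
  unfolding PLaur_tensor_def piecewise_Laurent_def
proof (intro CollectI allI impI conjI ballI)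
  fix \<mu> assume \<mu>: "\<mu> permutes {1..n - 1}"
  then show "push_family M n f \<mu> \<in> Laurent n" by (rule Laurent_push_family[OF M])
  fix i assume i: "i \<in> {1..<n - 1}"
  have "\<mu> i \<in> {1..n}" "\<mu> (i + 1) \<in> {1..n}"
    using transposed_in_range[OF \<mu> i] by auto
  then show "Laurent_dvd n (lvar (\<mu> i) - lvar (\<mu> (i + 1)))
      (push_family M n f \<mu> - push_family M n f (\<mu> \<circ> transpose i (i + 1)))"
    using Laurent_push_family[OF M \<mu>] Laurent_push_family[OF M permutes_transposed[OF \<mu> i]]
      subst_push_family_eq[OF \<mu> i M]
    by (simp add: Laurent_dvd_lvar_diff_iff Laurent_diff subst_var_diff)
qed

subsection \<open>The pushforward identity\<close>

lemma sum_insertions_eq: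
  assumes M: "matroid_on {1..n} M" and \<mu>: "\<mu> permutes {1..n - 1}"
  shows "(\<Sum>\<sigma>\<in>insertions n \<mu>. laurent_fract (f \<sigma>) * Q_cone n \<sigma> *
      (\<Prod>i\<in>{1..n} - greedy_basis M n \<sigma>. 1 - laurent_fract (lvar i))) =
    laurent_fract (push_family M n f \<mu>) * Q_cone (n - 1) \<mu> *
      (\<Prod>i\<in>{1..n - 1} - greedy_basis (deletion M {n}) (n - 1) \<mu>. 1 - laurent_fract (lvar i))"
proof -
  define L where "L = laurent_fract"
  define x where "x = L (lvar n)"
  define y where "y j = L (lvar (\<mu> j))" for j
  define F where "F j = L (f (ins n \<mu> j))" for j
  define g where "g j = L (g_poly n f \<mu> j)" for j
  \<comment> \<open>The end values are set separately: \<mu> fixes n, so at \<open>j = n\<close> the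
    quotient would have denominator zero.\<close>
  define A where "A j = (if j = 0 then 0 else if j = n then 1 else x / (x - y j))" for j
  define c where "c i = (\<Prod>p\<in>{1..n} - greedy_basis M n (ins n \<mu> i). 1 - L (lvar p))" for i
  let ?D = "greedy_basis (deletion M {n}) (n - 1) \<mu>"
  define d where "d = (\<Prod>p\<in>{1..n - 1} - ?D. 1 - L (lvar p))"
  have A: "A 0 = 0" "A n = 1" "\<And>j. j \<in> {1..<n} \<Longrightarrow> A j = x / (x - y j)"
    using n by (auto simp: A_def)
  have neq: "x \<noteq> y j" if "j \<in> {1..<n}" for j
    using permutes_lvar_neq(2)[OF \<mu> that] by (simp add: x_def y_def L_def)
  have diff: "F j - F (j + 1) = (x - y j) * g j" if "j \<in> {1..<n}" for j
    using arg_cong[OF g_poly(2)[OF \<mu> that], of L] by (simp add: F_def x_def y_def g_def L_def)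
  note incr = sum_increments[where A = A and F = F and g = g and x = x and y = y, OF n A neq diff]
  note incr_split = sum_increments_split[where A = A and F = F and g = g and x = x and y = y, OF n A neq diff]
  have h: "L (h_poly n f \<mu>) = F n + (\<Sum>j\<in>{1..<n}. x * g j)"
    by (simp add: h_poly_def F_def g_def x_def L_def laurent_fract_sum)
  \<comment> \<open>The position of n recovers the insertion index, so the sum over the set of
    insertions is a sum over positions.\<close>
  have "inj_on (ins n \<mu>) {1..n}"
  proof (rule inj_onI)
    fix i j assume ij: "i \<in> {1..n}" "j \<in> {1..n}" "ins n \<mu> i = ins n \<mu> j"
    then have "ins n \<mu> j i = ins n \<mu> j j" by (metis ins_same)
    moreover have "inj (ins n \<mu> j)" using ij(2) by (intro permutes_inj[OF ins_permutes[OF \<mu>]]) auto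
    ultimately show "i = j" by (metis injD)
  qed
  then have "(\<Sum>\<sigma>\<in>insertions n \<mu>. L (f \<sigma>) * Q_cone n \<sigma> *
      (\<Prod>i\<in>{1..n} - greedy_basis M n \<sigma>. 1 - L (lvar i))) =
    (\<Sum>i\<in>{1..n}. F i * Q_cone n (ins n \<mu> i) * c i)"
    by (simp add: insertions_def sum.reindex F_def c_def)
  also have "\<dots> = (\<Sum>i\<in>{1..n}. Q_cone (n - 1) \<mu> * (F i * (A i - A (i - 1)) * c i))"
  proof (rule sum.cong[OF refl])
    fix i assume "i \<in> {1..n}"
    then have "Q_cone n (ins n \<mu> i) = Q_cone (n - 1) \<mu> * (A i - A (i - 1))"
      using A by (intro Q_cone_ins[OF \<mu>, where x = x and y = y]) (auto simp: x_def y_def L_def)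
    then show "F i * Q_cone n (ins n \<mu> i) * c i = Q_cone (n - 1) \<mu> * (F i * (A i - A (i - 1)) * c i)"
      by (simp add: mult_ac)
  qed
  also have "\<dots> = Q_cone (n - 1) \<mu> * (\<Sum>i\<in>{1..n}. F i * (A i - A (i - 1)) * c i)"
    by (simp add: sum_distrib_left)
  also have "(\<Sum>i\<in>{1..n}. F i * (A i - A (i - 1)) * c i) = L (push_family M n f \<mu>) * d"
  proof -
    note compl = complement_greedy_basis_ins(1)[OF M \<mu>]
    consider "is_coloop M n" | "\<not> is_coloop M n" "is_loop M n" | "\<not> is_coloop M n" "\<not> is_loop M n"
      by blast
    then show ?thesis
    proof cases
      case 1
      \<comment> \<open>A coloop raises the rank at every position: n is always in the greedy basis
        and displaces nothing.\<close>
      have "c i = d" if "i \<in> {1..n}" for i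
      proof -
        have J: "{j. i \<le> j \<and> j < n \<and> raises M n \<mu> j \<and> \<not> raises M n \<mu> (Suc j)} = {}"
          using raises_coloop[OF M 1 \<mu> _ n] by auto
        show ?thesis
          using compl[of i] that raises_coloop[OF M 1 \<mu> _ n, of i] by (simp add: c_def d_def J)
      qed
      then have "(\<Sum>i\<in>{1..n}. F i * (A i - A (i - 1)) * c i) = (\<Sum>i\<in>{1..n}. F i * (A i - A (i - 1))) * d"
        by (simp add: sum_distrib_right)
      with 1 h incr show ?thesis by (simp add: push_family_def)
    next
      case 2
      \<comment> \<open>A loop never raises the rank, so it only contributes its own factor to the
        complement.\<close>
      have "c i = (1 - x) * d" if "i \<in> {1..n}" for i
      proof -
        have "n \<notin> {1..n - 1} - ?D" using n by auto
        then show ?thesis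
          using compl[of i] that not_raises_loop[OF M 2(2)] by (simp add: c_def d_def x_def)
      qed
      then have "(\<Sum>i\<in>{1..n}. F i * (A i - A (i - 1)) * c i) =
          (\<Sum>i\<in>{1..n}. F i * (A i - A (i - 1))) * ((1 - x) * d)"
        by (simp add: sum_distrib_right)
      with 2 h incr show ?thesis by (simp add: push_family_def L_def x_def)
    next
      case 3
      define k where "k = k_index M n \<mu>"
      have k: "1 \<le> k" "k < n" "\<And>p. p \<le> n \<Longrightarrow> raises M n \<mu> p \<longleftrightarrow> p \<le> k"
        using k_index[OF M 3 \<mu> n] by (simp_all add: k_def)
      \<comment> \<open>Up to position \<open>k\<close>, n displaces \<mu>(k), the only entry where
        raising stops; beyond \<open>k\<close>, n itself is left out of the greedy basis.\<close>
      have "c i = (if i \<le> k then 1 - y k else 1 - x) * d" if i: "i \<in> {1..n}" for i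
      proof (cases "i \<le> k")
        case True
        have "{j. i \<le> j \<and> j < n \<and> raises M n \<mu> j \<and> \<not> raises M n \<mu> (Suc j)} = {k}"
          using k True by (auto simp: k(3))
        then have "{1..n} - greedy_basis M n (ins n \<mu> i) = insert (\<mu> k) ({1..n - 1} - ?D)"
          using compl[of i] i k True by auto
        moreover have "\<mu> k \<in> ?D"
          using complement_greedy_basis_ins(2)[OF M \<mu>, of i k] i True k by simp
        ultimately show ?thesis using True by (simp add: c_def d_def y_def)
      next
        case False
        have J: "{j. i \<le> j \<and> j < n \<and> raises M n \<mu> j \<and> \<not> raises M n \<mu> (Suc j)} = {}"
          using k False by auto
        have "n \<notin> {1..n - 1} - ?D" using n by auto
        then show ?thesis
          using compl[of i] i k False by (simp add: c_def d_def x_def J)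
      qed
      then have "(\<Sum>i\<in>{1..n}. F i * (A i - A (i - 1)) * c i) =
          (\<Sum>i\<in>{1..n}. F i * (A i - A (i - 1)) * (if i \<le> k then 1 - y k else 1 - x)) * d"
        by (simp add: sum_distrib_left mult_ac)
      also have "\<dots> = (F n + (\<Sum>j\<in>{1..<n}. x * (1 - y (max j k)) * g j)) * d"
        using incr_split[OF _ _ _ k(1,2)] by simp
      also have "F n + (\<Sum>j\<in>{1..<n}. x * (1 - y (max j k)) * g j) = L (push_family M n f \<mu>)"
        unfolding push_family_neither[OF 3 k_index(2)[OF M 3 \<mu> n]] k_def[symmetric]
        by (simp add: F_def x_def y_def g_def L_def laurent_fract_sum)
      finally show ?thesis .
    qed
  qed
  finally show ?thesis by (simp add: L_def d_def mult_ac)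
qed

end

theorem proposition3p2:
  fixes n :: nat
    and M :: "nat set set"
    and f :: "(nat \<Rightarrow> nat) \<Rightarrow> laurent"
  assumes "n \<ge> 1"
    and "matroid_on {1..n} M"
    and "f \<in> PLaur n"
  shows "(\<forall>\<mu>. \<mu> permutes {1..n - 1} \<longrightarrow>
           (\<Sum>\<sigma>\<in>insertions n \<mu>. laurent_fract (f \<sigma>) * Q_cone n \<sigma> *
              (\<Prod>i\<in>{1..n} - greedy_basis M n \<sigma>. 1 - laurent_fract (lvar i)))
           = laurent_fract (push_family M n f \<mu>) * Q_cone (n - 1) \<mu> *
              (\<Prod>i\<in>{1..n - 1} - greedy_basis (deletion M {n}) (n - 1) \<mu>. 1 - laurent_fract (lvar i)))
         \<and> push_family M n f \<in> PLaur_tensor n"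
proof (intro conjI allI impI)
  fix \<mu> assume "\<mu> permutes {1..n - 1}"
  then show "(\<Sum>\<sigma>\<in>insertions n \<mu>. laurent_fract (f \<sigma>) * Q_cone n \<sigma> *
      (\<Prod>i\<in>{1..n} - greedy_basis M n \<sigma>. 1 - laurent_fract (lvar i))) =
    laurent_fract (push_family M n f \<mu>) * Q_cone (n - 1) \<mu> *
      (\<Prod>i\<in>{1..n - 1} - greedy_basis (deletion M {n}) (n - 1) \<mu>. 1 - laurent_fract (lvar i))"
    by (rule sum_insertions_eq[OF assms(1,3,2)])
next
  show "push_family M n f \<in> PLaur_tensor n"
    by (rule push_family_in_PLaur_tensor[OF assms(1,3,2)])
qed

end
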